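(* Let $\mathcal{A}$ and $\mathcal{U}$ be Banach algebras such that $\mathcal{U}$ is a Banach $\mathcal{A}$-bimodule with compatible actions and norm. Assume that every derivation $D$ on $\mathcal{A}\ltimes\mathcal{U}$ satisfies $D(\{0\}\times\mathcal{U})\subseteq\{0\}\times\mathcal{U}$. If $H^1(\mathcal{A})=(0)$ and $H^1(\mathcal{A},\mathcal{U})=(0)$, then there is a linear isomorphism $$H^1(\mathcal{A}\ltimes\mathcal{U})\cong\frac{Hom_{\mathcal{A}}(\mathcal{U})\cap Z^1(\mathcal{U})}{C_{\mathcal{A}}(\mathcal{U})+I(\mathcal{U})}.$$
   Context: All algebras are over $\mathbb{C}$. "Banach $\mathcal{A}$-bimodule with compatible actions and norm" means: $\|ax\|\le\|a\|\|x\|$, $\|xa\|\le\|x\|\|a\|$, and $a(xy)=(ax)y$, $(xy)a=x(ya)$, $(xa)y=x(ay)$ for all $a\in\mathcal{A}$, $x,y\in\mathcal{U}$. The semidirect product $\mathcal{A}\ltimes\mathcal{U}$ is $\mathcal{A}\times\mathcal{U}$ with multiplication $(a,x)(b,y)=(ab,\,ay+xb+xy)$ and norm $\|(a,x)\|=\|a\|+\|x\|$. For a Banach algebra $\mathcal{B}$ and a Banach $\mathcal{B}$-bimodule $\mathcal{X}$, a derivation $\delta:\mathcal{B}\to\mathcal{X}$ is a linear map with $\delta(bc)=b\delta(c)+\delta(b)c$; inner derivations are the maps $b\mapsto bx-xb$ with $x\in\mathcal{X}$; $Z^1(\mathcal{B},\mathcal{X})$ is the space of continuous derivations, $N^1(\mathcal{B},\mathcal{X})$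 the space of inner derivations, $H^1(\mathcal{B},\mathcal{X})=Z^1(\mathcal{B},\mathcal{X})/N^1(\mathcal{B},\mathcal{X})$; write $Z^1(\mathcal{B}),N^1(\mathcal{B}),H^1(\mathcal{B})$ when $\mathcal{X}=\mathcal{B}$. $Hom_{\mathcal{A}}(\mathcal{U})$ is the space of continuous $\mathcal{A}$-bimodule homomorphisms $\mathcal{U}\to\mathcal{U}$. Notation: $id_a(b)=ba-ab$ ($b\in\mathcal{A}$); $id_{\mathcal{A},x}:\mathcal{A}\to\mathcal{U}$, $id_{\mathcal{A},x}(b)=bx-xb$; $id_{\mathcal{U},x}:\mathcal{U}\to\mathcal{U}$, $id_{\mathcal{U},x}(y)=yx-xy$; $r_a:\mathcal{U}\to\mathcal{U}$, $r_a(y)=ya-ay$; $C_{\mathcal{A}}(\mathcal{U})=\{r_a\mid a\in\mathcal{A},\ id_a=0\}$; $I(\mathcal{U})=\{id_{\mathcal{U},x}\mid x\in\mathcal{U},\ id_{\mathcal{A},x}=0\}$ (both are linear subspaces of $Hom_{\mathcal{A}}(\mathcal{U})\cap Z^1(\mathcal{U})$). The symbol $\cong$ denotes isomorphism of linear spaces. *)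

theory Defs
  imports
    "HOL-Analysis.Analysis"
    "HOL-Library.Function_Algebras"
    "HOL-Library.Set_Algebras"
begin

section \<open>Complex Banach spaces and Banach algebras\<close>

class scaleC =
  fixes scaleC :: "complex \<Rightarrow> 'a \<Rightarrow> 'a"  (infixr "*\<^sub>C" 75)

class complex_vector = scaleC + ab_group_add +
  assumes scaleC_add_right: "a *\<^sub>C (x + y) = a *\<^sub>C x + a *\<^sub>C y"
    and scaleC_add_left: "(a + b) *\<^sub>C x = a *\<^sub>C x + b *\<^sub>C x"
    and scaleC_scaleC: "a *\<^sub>C (b *\<^sub>C x) = (a * b) *\<^sub>C x"
    and scaleC_one: "1 *\<^sub>C x = x"

global_interpretation complex_vector: vector_space "scaleC :: complex \<Rightarrow> 'a \<Rightarrow> 'a::complex_vector"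
  by unfold_locales (fact scaleC_add_right scaleC_add_left scaleC_scaleC scaleC_one)+

abbreviation clinear :: "('a::complex_vector \<Rightarrow> 'b::complex_vector) \<Rightarrow> bool" where
  "clinear \<equiv> Vector_Spaces.linear scaleC scaleC"

class complex_normed_vector = complex_vector + real_normed_vector +
  assumes scaleR_scaleC: "r *\<^sub>R x = complex_of_real r *\<^sub>C x"
    and norm_scaleC: "norm (c *\<^sub>C x) = cmod c * norm x"

class complex_banach = complex_normed_vector + banach

text \<open>Banach algebras are not required to have a unit.\<close>

class complex_banach_algebra = complex_banach + real_normed_algebra +
  assumes mult_scaleC_left: "(c *\<^sub>C x) * y = c *\<^sub>C (x * y)"
    and mult_scaleC_right: "x * (c *\<^sub>C y) = c *\<^sub>C (x * y)"

instantiation "fun" :: (type, complex_vector) complex_vector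
begin

definition scaleC_fun :: "complex \<Rightarrow> ('a \<Rightarrow> 'b) \<Rightarrow> 'a \<Rightarrow> 'b" where
  "scaleC_fun c f = (\<lambda>x. c *\<^sub>C f x)"

instance
  by standard
    (auto simp: scaleC_fun_def fun_eq_iff scaleC_add_right scaleC_add_left scaleC_scaleC scaleC_one)

end


section \<open>Bimodules with compatible actions and norm\<close>

locale compatible_bimodule =
  fixes lact :: "'a::complex_banach_algebra \<Rightarrow> 'u::complex_banach_algebra \<Rightarrow> 'u"
    and ract :: "'u \<Rightarrow> 'a \<Rightarrow> 'u"
  assumes lact_clinear_left: "clinear (\<lambda>a. lact a x)"
    and lact_clinear_right: "clinear (\<lambda>x. lact a x)"
    and ract_clinear_left: "clinear (\<lambda>x. ract x a)"
    and ract_clinear_right: "clinear (\<lambda>a. ract x a)"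
    and lact_assoc: "lact (a * b) x = lact a (lact b x)"
    and ract_assoc: "ract x (a * b) = ract (ract x a) b"
    and lact_ract: "lact a (ract x b) = ract (lact a x) b"
    and norm_lact: "norm (lact a x) \<le> norm a * norm x"
    and norm_ract: "norm (ract x a) \<le> norm x * norm a"
    and lact_mult: "lact a (x * y) = lact a x * y"
    and mult_ract: "ract (x * y) a = x * ract y a"
    and ract_mult_lact: "ract x a * y = x * lact a y"


section \<open>The semidirect product\<close>

text \<open>
  The library's product type carries the Euclidean norm, so the underlying Banach space of the
  semidirect product, whose norm is the sum of the two norms, is a type of its own. Its
  multiplication depends on the two actions and is therefore an explicit function.
\<close>

datatype ('a, 'u) semidirect = SD (sd_fst: 'a) (sd_snd: 'u)

instantiation semidirect :: (complex_vector, complex_vector) complex_vector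
begin

definition zero_semidirect :: "('a, 'b) semidirect" where
  "0 = SD 0 0"
definition plus_semidirect :: "('a, 'b) semidirect \<Rightarrow> ('a, 'b) semidirect \<Rightarrow> ('a, 'b) semidirect" where
  "p + q = SD (sd_fst p + sd_fst q) (sd_snd p + sd_snd q)"
definition minus_semidirect :: "('a, 'b) semidirect \<Rightarrow> ('a, 'b) semidirect \<Rightarrow> ('a, 'b) semidirect" where
  "p - q = SD (sd_fst p - sd_fst q) (sd_snd p - sd_snd q)"
definition uminus_semidirect :: "('a, 'b) semidirect \<Rightarrow> ('a, 'b) semidirect" where
  "- p = SD (- sd_fst p) (- sd_snd p)"
definition scaleC_semidirect :: "complex \<Rightarrow> ('a, 'b) semidirect \<Rightarrow> ('a, 'b) semidirect" where
  "c *\<^sub>C p = SD (c *\<^sub>C sd_fst p) (c *\<^sub>C sd_snd p)"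

instance
  by standard
    (simp_all add: zero_semidirect_def plus_semidirect_def minus_semidirect_def
      uminus_semidirect_def scaleC_semidirect_def semidirect.expand
      scaleC_add_right scaleC_add_left scaleC_scaleC scaleC_one algebra_simps)

end

instantiation semidirect :: (complex_normed_vector, complex_normed_vector) complex_normed_vector
begin

definition scaleR_semidirect :: "real \<Rightarrow> ('a, 'b) semidirect \<Rightarrow> ('a, 'b) semidirect" where
  "r *\<^sub>R p = SD (r *\<^sub>R sd_fst p) (r *\<^sub>R sd_snd p)"
definition norm_semidirect :: "('a, 'b) semidirect \<Rightarrow> real" where
  "norm p = norm (sd_fst p) + norm (sd_snd p)"
definition sgn_semidirect :: "('a, 'b) semidirect \<Rightarrow> ('a, 'b) semidirect" where
  "sgn (p :: ('a, 'b) semidirect) = inverse (norm p) *\<^sub>R p"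
definition dist_semidirect :: "('a, 'b) semidirect \<Rightarrow> ('a, 'b) semidirect \<Rightarrow> real" where
  "dist (p :: ('a, 'b) semidirect) q = norm (p - q)"
definition uniformity_semidirect :: "(('a, 'b) semidirect \<times> ('a, 'b) semidirect) filter" where
  "uniformity_semidirect = (INF e\<in>{0<..}. principal {(p :: ('a, 'b) semidirect, q). dist p q < e})"
definition open_semidirect :: "('a, 'b) semidirect set \<Rightarrow> bool" where
  "open_semidirect S \<longleftrightarrow> (\<forall>p\<in>S. \<forall>\<^sub>F (p', q :: ('a, 'b) semidirect) in uniformity. p' = p \<longrightarrow> q \<in> S)"

instance
proof
  fix p q :: "('a, 'b) semidirect" and r s :: real and c :: complex
  show "norm (p + q) \<le> norm p + norm q"
    unfolding norm_semidirect_def plus_semidirect_def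
    using norm_triangle_ineq[of "sd_fst p" "sd_fst q"] norm_triangle_ineq[of "sd_snd p" "sd_snd q"]
    by simp
  show "norm p = 0 \<longleftrightarrow> p = 0"
    unfolding norm_semidirect_def zero_semidirect_def
    by (cases p) (simp add: add_nonneg_eq_0_iff)
  show "r *\<^sub>R p = complex_of_real r *\<^sub>C p"
    by (simp add: scaleR_semidirect_def scaleC_semidirect_def scaleR_scaleC)
  show "norm (c *\<^sub>C p) = cmod c * norm p"
    by (simp add: norm_semidirect_def scaleC_semidirect_def norm_scaleC distrib_left)
  show "norm (r *\<^sub>R p) = \<bar>r\<bar> * norm p"
    by (simp add: norm_semidirect_def scaleR_semidirect_def distrib_left)
qed (simp_all add: plus_semidirect_def scaleR_semidirect_def
      sgn_semidirect_def dist_semidirect_def uniformity_semidirect_def open_semidirect_def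
      semidirect.expand scaleR_add_right scaleR_add_left)

end

instance semidirect :: (complex_banach, complex_banach) complex_banach
proof
  fix X :: "nat \<Rightarrow> ('a, 'b) semidirect"
  assume X: "Cauchy X"
  have "dist (sd_fst p) (sd_fst q) \<le> dist p q" and "dist (sd_snd p) (sd_snd q) \<le> dist p q"
    for p q :: "('a, 'b) semidirect"
    by (simp_all add: dist_norm norm_semidirect_def minus_semidirect_def)
  with X have "Cauchy (\<lambda>n. sd_fst (X n))" and "Cauchy (\<lambda>n. sd_snd (X n))"
    unfolding Cauchy_def by (meson le_less_trans)+
  then obtain a x where a: "(\<lambda>n. sd_fst (X n)) \<longlonglongrightarrow> a" and x: "(\<lambda>n. sd_snd (X n)) \<longlonglongrightarrow> x"
    by (auto simp: convergent_def dest!: Cauchy_convergent)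
  have "(\<lambda>n. dist (sd_fst (X n)) a + dist (sd_snd (X n)) x) \<longlonglongrightarrow> 0 + 0"
    by (intro tendsto_add a[THEN tendsto_dist_iff[THEN iffD1]] x[THEN tendsto_dist_iff[THEN iffD1]])
  moreover have "dist (X n) (SD a x) = dist (sd_fst (X n)) a + dist (sd_snd (X n)) x" for n
    by (simp add: dist_norm norm_semidirect_def minus_semidirect_def)
  ultimately have "(\<lambda>n. dist (X n) (SD a x)) \<longlonglongrightarrow> 0"
    by simp
  then have "X \<longlonglongrightarrow> SD a x"
    by (rule tendsto_dist_iff[THEN iffD2])
  then show "convergent X"
    by (rule convergentI)
qed

definition sd_mult ::
  "('a::complex_banach_algebra \<Rightarrow> 'u::complex_banach_algebra \<Rightarrow> 'u) \<Rightarrow> ('u \<Rightarrow> 'a \<Rightarrow> 'u) \<Rightarrow>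
    ('a, 'u) semidirect \<Rightarrow> ('a, 'u) semidirect \<Rightarrow> ('a, 'u) semidirect" where
  "sd_mult lact ract p q =
     SD (sd_fst p * sd_fst q)
        (lact (sd_fst p) (sd_snd q) + ract (sd_snd p) (sd_fst q) + sd_snd p * sd_snd q)"


section \<open>Quotients of linear spaces\<close>

text \<open>
  Elements of the quotient of \<open>V\<close> by \<open>W\<close> are cosets \<open>f +o W\<close>. Cosets are added with the sum of
  sets. In \<open>coset_scale\<close> the summand \<open>W\<close> only matters for the scalar 0, where the set of
  multiples is \<open>{0}\<close> instead of \<open>W\<close>.
\<close>

definition quotient_space :: "'v::complex_vector set \<Rightarrow> 'v set \<Rightarrow> 'v set set" where
  "quotient_space V W = (\<lambda>f. f +o W) ` V"

definition coset_scale :: "'v::complex_vector set \<Rightarrow> complex \<Rightarrow> 'v set \<Rightarrow> 'v set" where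
  "coset_scale W c X = scaleC c ` X + W"

definition cosets_isomorphic ::
  "'v::complex_vector set set \<Rightarrow> (complex \<Rightarrow> 'v set \<Rightarrow> 'v set) \<Rightarrow>
    'w::complex_vector set set \<Rightarrow> (complex \<Rightarrow> 'w set \<Rightarrow> 'w set) \<Rightarrow> bool" where
  "cosets_isomorphic Q s Q' s' \<longleftrightarrow>
     (\<exists>\<phi>. bij_betw \<phi> Q Q' \<and>
        (\<forall>X\<in>Q. \<forall>Y\<in>Q. \<phi> (X + Y) = \<phi> X + \<phi> Y) \<and>
        (\<forall>c. \<forall>X\<in>Q. \<phi> (s c X) = s' c (\<phi> X)))"


section \<open>Derivations and first cohomology\<close>

text \<open>
  Derivations from an algebra with multiplication \<open>m\<close> into a bimodule with left action \<open>l\<close> and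
  right action \<open>r\<close>. They need not be continuous.
\<close>

definition derivation ::
  "('b \<Rightarrow> 'b \<Rightarrow> 'b) \<Rightarrow> ('b \<Rightarrow> 'x \<Rightarrow> 'x) \<Rightarrow> ('x \<Rightarrow> 'b \<Rightarrow> 'x) \<Rightarrow>
    ('b::complex_vector \<Rightarrow> 'x::complex_vector) \<Rightarrow> bool" where
  "derivation m l r D \<longleftrightarrow> clinear D \<and> (\<forall>b c. D (m b c) = l b (D c) + r (D b) c)"

definition inner_derivation ::
  "('b \<Rightarrow> 'x \<Rightarrow> 'x) \<Rightarrow> ('x \<Rightarrow> 'b \<Rightarrow> 'x) \<Rightarrow> 'x \<Rightarrow> 'b \<Rightarrow> 'x::complex_vector" where
  "inner_derivation l r x = (\<lambda>b. l b x - r x b)"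

definition Z1 ::
  "('b \<Rightarrow> 'b \<Rightarrow> 'b) \<Rightarrow> ('b \<Rightarrow> 'x \<Rightarrow> 'x) \<Rightarrow> ('x \<Rightarrow> 'b \<Rightarrow> 'x) \<Rightarrow>
    ('b::complex_normed_vector \<Rightarrow> 'x::complex_normed_vector) set" where
  "Z1 m l r = {D. derivation m l r D \<and> continuous_on UNIV D}"

definition N1 :: "('b \<Rightarrow> 'x \<Rightarrow> 'x) \<Rightarrow> ('x \<Rightarrow> 'b \<Rightarrow> 'x) \<Rightarrow> ('b \<Rightarrow> 'x::complex_vector) set" where
  "N1 l r = range (inner_derivation l r)"

definition H1 ::
  "('b \<Rightarrow> 'b \<Rightarrow> 'b) \<Rightarrow> ('b \<Rightarrow> 'x \<Rightarrow> 'x) \<Rightarrow> ('x \<Rightarrow> 'b \<Rightarrow> 'x) \<Rightarrow>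
    ('b::complex_normed_vector \<Rightarrow> 'x::complex_normed_vector) set set" where
  "H1 m l r = quotient_space (Z1 m l r) (N1 l r)"

abbreviation "Z1_alg m \<equiv> Z1 m m m"
abbreviation "N1_alg m \<equiv> N1 m m"
abbreviation "H1_alg m \<equiv> H1 m m m"

definition Hom_bimodule ::
  "('a \<Rightarrow> 'u \<Rightarrow> 'u) \<Rightarrow> ('u \<Rightarrow> 'a \<Rightarrow> 'u) \<Rightarrow> ('u::complex_normed_vector \<Rightarrow> 'u) set" where
  "Hom_bimodule lact ract =
     {T. clinear T \<and> continuous_on UNIV T \<and>
         (\<forall>a x. T (lact a x) = lact a (T x)) \<and> (\<forall>x a. T (ract x a) = ract (T x) a)}"

definition C_space ::
  "('a::complex_banach_algebra \<Rightarrow> 'u \<Rightarrow> 'u) \<Rightarrow> ('u \<Rightarrow> 'a \<Rightarrow> 'u) \<Rightarrow> ('u::complex_banach_algebra \<Rightarrow> 'u) set" where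
  "C_space lact ract =
     {(\<lambda>y. ract y a - lact a y) | a. inner_derivation times times a = 0}"

definition I_space ::
  "('a::complex_banach_algebra \<Rightarrow> 'u \<Rightarrow> 'u) \<Rightarrow> ('u \<Rightarrow> 'a \<Rightarrow> 'u) \<Rightarrow> ('u::complex_banach_algebra \<Rightarrow> 'u) set" where
  "I_space lact ract =
     {inner_derivation times times x | x. inner_derivation lact ract x = 0}"

end

theory Submission
  imports Defs
begin

text \<open>
  Write a derivation \<open>D\<close> of the semidirect product as a two by two matrix of linear maps. The
  hypothesis on \<open>{0} \<times> \<U>\<close> says that the entry \<open>\<U> \<rightarrow> \<A>\<close> is zero, and then the restriction of \<open>D\<close> to
  \<open>\<A> \<times> {0}\<close> consists of a derivation \<open>\<A> \<rightarrow> \<A>\<close> and a derivation \<open>\<A> \<rightarrow> \<U>\<close>. If \<open>D\<close> is continuous,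
  vanishing cohomology makes both of them inner, given by some \<open>a\<close> and some \<open>x\<close>. The inner derivation
  of \<open>(a, x)\<close> has the same restriction, so subtracting it leaves a derivation \<open>(b, y) \<mapsto> (0, T y)\<close>.
  Hence every cohomology class is represented by the extension by zero of some \<open>T : \<U> \<rightarrow> \<U>\<close>
  (\<open>Z1_subset_extensions_plus_N1\<close>).

  It remains to see which \<open>T\<close> occur and when the class is trivial. The extension is a continuous
  derivation iff \<open>T\<close> is a continuous bimodule homomorphism and a derivation
  (\<open>extend_by_zero_in_Z1_iff\<close>). It is inner iff \<open>T\<close> lies in the sum of the two subspaces
  in the denominator (\<open>C_plus_I_eq\<close>): the inner derivation of \<open>(a, x)\<close> vanishes on \<open>\<A> \<times> {0}\<close>
  exactly if \<open>a\<close> and \<open>x\<close> both commute with \<open>\<A>\<close>, as the definitions of these subspaces demand. The isomorphism is then a case of the first isomorphism theorem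
  (\<open>cosets_isomorphic_if_represented\<close>).
\<close>


section \<open>Complex linear maps and quotient spaces\<close>

lemma clinearI:
  assumes "\<And>x y. f (x + y) = f x + f y" and "\<And>c x. f (c *\<^sub>C x) = c *\<^sub>C f x"
  shows "clinear f"
  using assms
  by (simp add: Vector_Spaces.linear_iff complex_vector.vector_space_axioms)

lemma clinearD:
  assumes "clinear f"
  shows "f (x + y) = f x + f y" and "f (c *\<^sub>C x) = c *\<^sub>C f x"
    and "f 0 = 0" and "f (x - y) = f x - f y"
proof -
  interpret module_hom scaleC scaleC f
    using assms by (simp add: Vector_Spaces.linear_def)
  show "f (x + y) = f x + f y" "f (c *\<^sub>C x) = c *\<^sub>C f x" "f 0 = 0" "f (x - y) = f x - f y"
    by (simp_all add: add scale zero diff)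
qed

lemma continuous_on_if_clinear_bounded:
  fixes f :: "'v::complex_normed_vector \<Rightarrow> 'w::complex_normed_vector"
  assumes "clinear f" and "\<And>x. norm (f x) \<le> norm x * K"
  shows "continuous_on S f"
proof -
  have "bounded_linear f"
    by (rule bounded_linear_intro[of _ K])
      (simp_all add: scaleR_scaleC clinearD[OF assms(1)] assms(2))
  then show ?thesis
    by (rule linear_continuous_on)
qed

lemma mem_coset_self:
  assumes "complex_vector.subspace W"
  shows "f \<in> f +o W"
  using complex_vector.subspace_0[OF assms] by (force simp: elt_set_plus_def)

lemma mem_coset_iff:
  fixes f g :: "'v::ab_group_add"
  shows "f \<in> g +o W \<longleftrightarrow> f - g \<in> W"
  by (force simp: elt_set_plus_def)

lemma coset_eq_iff:
  assumes "complex_vector.subspace W"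
  shows "f +o W = g +o W \<longleftrightarrow> f - g \<in> W"
proof
  assume "f +o W = g +o W"
  then show "f - g \<in> W"
    using mem_coset_self[OF assms, of f] by (simp add: mem_coset_iff)
next
  assume *: "f - g \<in> W"
  have "h - f \<in> W \<longleftrightarrow> h - g \<in> W" for h
    using complex_vector.subspace_add[OF assms _ *, of "h - f"]
      complex_vector.subspace_diff[OF assms _ *, of "h - g"] by auto
  then show "f +o W = g +o W"
    by (auto simp: mem_coset_iff)
qed

lemma coset_add:
  assumes "complex_vector.subspace W"
  shows "(f +o W) + (g +o W) = (f + g) +o W"
proof -
  have "W + W = W"
    using complex_vector.subspace_0[OF assms] complex_vector.subspace_add[OF assms]
    by (force simp: set_plus_def)
  then show ?thesis
    by (simp add: set_plus_rearrange)
qed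

lemma coset_scale_coset:
  assumes "complex_vector.subspace W"
  shows "coset_scale W c (f +o W) = (c *\<^sub>C f) +o W"
proof -
  have "scaleC c ` (f +o W) + W = (c *\<^sub>C f) +o W"
  proof (intro equalityI subsetI)
    fix h assume "h \<in> scaleC c ` (f +o W) + W"
    then obtain v w where "v \<in> W" "w \<in> W" "h = c *\<^sub>C (f + v) + w"
      by (auto simp: set_plus_def elt_set_plus_def)
    then show "h \<in> (c *\<^sub>C f) +o W"
      using complex_vector.subspace_add[OF assms complex_vector.subspace_scale[OF assms]]
      by (simp add: mem_coset_iff scaleC_add_right)
  next
    fix h assume "h \<in> (c *\<^sub>C f) +o W"
    then obtain w where "w \<in> W" "h = c *\<^sub>C f + w"
      by (auto simp: elt_set_plus_def)
    then show "h \<in> scaleC c ` (f +o W) + W"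
      using mem_coset_self[OF assms] by auto
  qed
  then show ?thesis
    by (simp add: coset_scale_def)
qed

text \<open>
  This is the first isomorphism theorem for the map \<open>V \<rightarrow> Z / N\<close> induced by \<open>e\<close>: it is onto because
  \<open>Z \<subseteq> e ` V + N\<close>, and its kernel is \<open>W\<close>. The isomorphism is taken from \<open>Z / N\<close> to \<open>V / W\<close>, where
  it needs no choice of representatives: it sends a coset to its preimage under \<open>e\<close> in \<open>V\<close>.
\<close>

lemma cosets_isomorphic_if_represented:
  fixes e :: "'v::complex_vector \<Rightarrow> 'z::complex_vector"
  assumes V: "complex_vector.subspace V" and N: "complex_vector.subspace N" and e: "clinear e"
    and into: "e ` V \<subseteq> Z" and onto: "Z \<subseteq> e ` V + N"
    and W: "W = {T \<in> V. e T \<in> N}"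
  shows "cosets_isomorphic (quotient_space Z N) (coset_scale N) (quotient_space V W) (coset_scale W)"
proof -
  define \<phi> where "\<phi> X = {T \<in> V. e T \<in> X}" for X
  have subW: "complex_vector.subspace W"
    unfolding W complex_vector.subspace_def
    by (auto simp: clinearD[OF e] complex_vector.subspace_0 complex_vector.subspace_add
        complex_vector.subspace_scale V N)
  have Q: "quotient_space Z N = (\<lambda>T. e T +o N) ` V"
  proof -
    have "\<exists>T\<in>V. D +o N = e T +o N" if "D \<in> Z" for D
    proof -
      obtain T n where "T \<in> V" "n \<in> N" "D = e T + n"
        using onto \<open>D \<in> Z\<close> by (auto simp: set_plus_def)
      then show ?thesis
        by (intro bexI[of _ T]) (simp_all add: coset_eq_iff[OF N])
    qed
    then show ?thesis
      using into unfolding quotient_space_def by blast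
  qed
  have \<phi>: "\<phi> (e T +o N) = T +o W" if "T \<in> V" for T
    using complex_vector.subspace_add[OF V _ that] complex_vector.subspace_diff[OF V _ that]
    by (auto simp: \<phi>_def W mem_coset_iff clinearD[OF e]) (metis diff_add_cancel)
  have "inj_on \<phi> (quotient_space Z N)"
    unfolding Q
  proof (rule inj_onI)
    fix X Y assume "X \<in> (\<lambda>T. e T +o N) ` V" "Y \<in> (\<lambda>T. e T +o N) ` V" and eq: "\<phi> X = \<phi> Y"
    then obtain S T where S: "S \<in> V" "X = e S +o N" and T: "T \<in> V" "Y = e T +o N"
      by blast
    have "S - T \<in> W"
      using eq by (simp add: S T \<phi> coset_eq_iff[OF subW])
    then show "X = Y"
      by (simp add: S T coset_eq_iff[OF N] W clinearD[OF e])
  qed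
  moreover have "\<phi> ` quotient_space Z N = quotient_space V W"
    unfolding Q unfolding quotient_space_def image_image using \<phi> by simp
  moreover have "\<phi> (X + Y) = \<phi> X + \<phi> Y"
    if "X \<in> quotient_space Z N" "Y \<in> quotient_space Z N" for X Y
    using that complex_vector.subspace_add[OF V] unfolding Q
    by (auto simp: \<phi> coset_add[OF N] coset_add[OF subW] simp flip: clinearD(1)[OF e])
  moreover have "\<phi> (coset_scale N c X) = coset_scale W c (\<phi> X)" if "X \<in> quotient_space Z N" for c X
    using that complex_vector.subspace_scale[OF V] unfolding Q
    by (auto simp: \<phi> coset_scale_coset[OF N] coset_scale_coset[OF subW]
        simp flip: clinearD(2)[OF e])
  ultimately show ?thesis
    unfolding cosets_isomorphic_def bij_betw_def
    by (intro exI[of _ \<phi>] conjI ballI allI)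
qed


section \<open>Spaces of derivations\<close>

lemma subspace_Z1:
  assumes l: "\<And>b. clinear (l b)" and r: "\<And>b. clinear (\<lambda>x. r x b)"
  shows "complex_vector.subspace (Z1 m l r)"
proof -
  have add: "D + E \<in> Z1 m l r" if "D \<in> Z1 m l r" "E \<in> Z1 m l r" for D E
  proof -
    have D: "clinear D" "D (m b c) = l b (D c) + r (D b) c" "continuous_on UNIV D"
      and E: "clinear E" "E (m b c) = l b (E c) + r (E b) c" "continuous_on UNIV E" for b c
      using that by (simp_all add: Z1_def derivation_def)
    have "clinear (D + E)"
      by (intro clinearI) (simp_all add: clinearD[OF D(1)] clinearD[OF E(1)] scaleC_add_right)
    moreover have "continuous_on UNIV (D + E)"
      unfolding plus_fun_def by (intro continuous_on_add D E)
    moreover have "(D + E) (m b c) = l b ((D + E) c) + r ((D + E) b) c" for b c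
      by (simp add: D(2) E(2) clinearD[OF l] clinearD[OF r])
    ultimately show ?thesis
      by (simp add: Z1_def derivation_def)
  qed
  have scale: "k *\<^sub>C D \<in> Z1 m l r" if "D \<in> Z1 m l r" for k D
  proof -
    have D: "clinear D" "D (m b c) = l b (D c) + r (D b) c" "continuous_on UNIV D" for b c
      using that by (simp_all add: Z1_def derivation_def)
    have "continuous_on (range D) (\<lambda>x. k *\<^sub>C x)"
      by (rule continuous_on_if_clinear_bounded[where K = "cmod k"])
        (auto intro!: clinearI simp: scaleC_add_right scaleC_scaleC norm_scaleC mult.commute)
    then have "continuous_on UNIV (\<lambda>x. k *\<^sub>C D x)"
      using continuous_on_compose[OF D(3)] by (simp add: o_def)
    moreover have "clinear (\<lambda>x. k *\<^sub>C D x)"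
      by (intro clinearI)
        (simp_all add: clinearD[OF D(1)] scaleC_add_right scaleC_scaleC mult.commute)
    ultimately show ?thesis
      by (simp add: Z1_def derivation_def scaleC_fun_def D(2) clinearD[OF l] clinearD[OF r]
          scaleC_add_right)
  qed
  have "0 \<in> Z1 m l r"
    by (auto simp: Z1_def derivation_def clinearD[OF l] clinearD[OF r] zero_fun_def
        intro!: clinearI)
  with add scale show ?thesis
    by (simp add: complex_vector.subspace_def)
qed

lemma subspace_N1:
  assumes l: "\<And>b. clinear (l b)" and r: "\<And>b. clinear (\<lambda>x. r x b)"
  shows "complex_vector.subspace (N1 l r)"
proof -
  have "clinear (inner_derivation l r)"
    by (intro clinearI)
      (auto simp: inner_derivation_def fun_eq_iff clinearD[OF l] clinearD[OF r] scaleC_fun_def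
        complex_vector.scale_right_diff_distrib)
  then show ?thesis
    unfolding N1_def
    by (intro module_hom.subspace_image[of scaleC scaleC])
      (simp_all add: Vector_Spaces.linear_def complex_vector.subspace_UNIV)
qed

lemma inner_if_H1_trivial:
  assumes l: "\<And>b. clinear (l b)" and r: "\<And>b. clinear (\<lambda>x. r x b)"
    and H1: "H1 m l r = {N1 l r}" and D: "D \<in> Z1 m l r"
  obtains x where "D = inner_derivation l r x"
proof -
  have "D +o N1 l r = N1 l r"
    using H1 D by (auto simp: H1_def quotient_space_def)
  then have "D \<in> N1 l r"
    using mem_coset_self[OF subspace_N1, of l r D] l r by simp
  then show ?thesis
    using that by (auto simp: N1_def)
qed

lemma clinear_times:
  fixes b :: "'a::complex_banach_algebra"
  shows "clinear (times b)" and "clinear (\<lambda>x. x * b)"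
  by (auto intro!: clinearI simp: algebra_simps mult_scaleC_left mult_scaleC_right)


section \<open>Derivations of the semidirect product\<close>

lemmas semidirect_defs = plus_semidirect_def minus_semidirect_def zero_semidirect_def
  scaleC_semidirect_def

lemma continuous_on_semidirect_maps:
  "continuous_on S (sd_fst :: ('a::complex_normed_vector, 'u::complex_normed_vector) semidirect \<Rightarrow> 'a)"
  "continuous_on S (sd_snd :: ('a, 'u) semidirect \<Rightarrow> 'u)"
  "continuous_on S' (\<lambda>a. SD a 0 :: ('a, 'u) semidirect)"
  "continuous_on S'' (SD 0 :: 'u \<Rightarrow> ('a, 'u) semidirect)"
  by (auto intro!: continuous_on_if_clinear_bounded[where K = 1] clinearI
      simp: semidirect_defs norm_semidirect_def)

definition extend_by_zero ::
  "('u \<Rightarrow> 'u) \<Rightarrow> ('a, 'u) semidirect \<Rightarrow> ('a::complex_vector, 'u::complex_vector) semidirect" where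
  "extend_by_zero T p = SD 0 (T (sd_snd p))"

lemma clinear_extend_by_zero: "clinear extend_by_zero"
  by (intro clinearI)
    (auto simp: extend_by_zero_def fun_eq_iff semidirect_defs scaleC_fun_def)

context compatible_bimodule
begin

abbreviation "mul \<equiv> sd_mult lact ract"

lemmas act_simps =
  clinearD[OF lact_clinear_left] clinearD[OF lact_clinear_right]
  clinearD[OF ract_clinear_left] clinearD[OF ract_clinear_right]

lemma clinear_mul: "clinear (mul p)" and clinear_mul': "clinear (\<lambda>q. mul q p)"
  by (auto intro!: clinearI
      simp: sd_mult_def semidirect_defs act_simps algebra_simps
        scaleC_add_right mult_scaleC_left mult_scaleC_right)

text \<open>
  By trilinearity it is enough to take each factor from \<open>\<A>\<close> or from \<open>\<U>\<close>. Two factors from \<open>\<A>\<close> and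
  one from \<open>\<U>\<close> give the bimodule axioms, one from \<open>\<A>\<close> and two from \<open>\<U>\<close> the compatibility of the
  actions with the product of \<open>\<U>\<close>.
\<close>

lemma mul_assoc: "mul (mul p q) r = mul p (mul q r)"
  by (simp add: sd_mult_def act_simps algebra_simps lact_assoc ract_assoc lact_ract
      lact_mult mult_ract ract_mult_lact)

lemma norm_mul: "norm (mul p q) \<le> norm p * norm q"
proof -
  obtain a x where p: "p = SD a x" by (cases p)
  obtain b y where q: "q = SD b y" by (cases q)
  have "norm (a * b) + norm (lact a y + ract x b + x * y)
      \<le> norm (a * b) + (norm (lact a y) + norm (ract x b) + norm (x * y))"
    by (intro add_left_mono order.trans[OF norm_triangle_ineq] add_right_mono norm_triangle_ineq)
  also have "\<dots> \<le> norm a * norm b + (norm a * norm y + norm x * norm b + norm x * norm y)"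
    by (intro add_mono norm_mult_ineq norm_lact norm_ract)
  finally show ?thesis
    by (simp add: p q sd_mult_def norm_semidirect_def algebra_simps)
qed

lemma N1_subset_Z1: "N1_alg mul \<subseteq> Z1_alg mul"
proof
  fix D assume "D \<in> N1_alg mul"
  then obtain p where D: "D = inner_derivation mul mul p"
    by (auto simp: N1_def)
  have lin: "clinear D"
    by (auto intro!: clinearI simp: D inner_derivation_def clinearD[OF clinear_mul]
        clinearD[OF clinear_mul'] complex_vector.scale_right_diff_distrib)
  have "norm (D q) \<le> norm q * (2 * norm p)" for q
    using norm_triangle_ineq4[of "mul q p" "mul p q"] norm_mul[of q p] norm_mul[of p q]
    by (simp add: D inner_derivation_def algebra_simps)
  then have "continuous_on UNIV D"
    by (rule continuous_on_if_clinear_bounded[OF lin])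
  moreover have "D (mul q r) = mul q (D r) + mul (D q) r" for q r
    by (simp add: D inner_derivation_def clinearD[OF clinear_mul] clinearD[OF clinear_mul']
        mul_assoc)
  ultimately show "D \<in> Z1_alg mul"
    using lin by (simp add: Z1_def derivation_def)
qed

lemma inner_derivation_semidirect:
  "inner_derivation mul mul (SD a x) (SD b y) =
     SD (inner_derivation times times a b)
        (inner_derivation lact ract x b + (ract y a - lact a y) + inner_derivation times times x y)"
  by (simp add: inner_derivation_def sd_mult_def semidirect_defs algebra_simps)

text \<open>
  Evaluated on the products \<open>(a, x)(b, y)\<close>, the derivation identity for the extension of \<open>T\<close> says
  \<open>T (a y + x b + x y) = a (T y) + (T x) b + x (T y) + (T x) y\<close>. Setting some of the four arguments
  to 0 splits this into the two homomorphism identities and the derivation identity on \<open>\<U>\<close>.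
\<close>

lemma extend_by_zero_in_Z1_iff:
  "extend_by_zero T \<in> Z1_alg mul \<longleftrightarrow> T \<in> Hom_bimodule lact ract \<inter> Z1_alg times"
proof
  assume E: "extend_by_zero T \<in> Z1_alg mul"
  then have lin: "clinear (extend_by_zero T :: ('a, 'u) semidirect \<Rightarrow> _)"
    and der: "extend_by_zero T (mul p q) = mul p (extend_by_zero T q) + mul (extend_by_zero T p) q"
    and cont: "continuous_on UNIV (extend_by_zero T :: ('a, 'u) semidirect \<Rightarrow> _)" for p q
    by (auto simp: Z1_def derivation_def)
  have T_lin: "clinear T"
    using clinearD(1)[OF lin, of "SD 0 _" "SD 0 _"] clinearD(2)[OF lin, of _ "SD 0 _"]
    by (auto intro!: clinearI simp: extend_by_zero_def semidirect_defs)
  have "continuous_on UNIV (sd_snd \<circ> extend_by_zero T \<circ> (SD 0 :: 'u \<Rightarrow> ('a, 'u) semidirect))"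
    by (intro continuous_on_compose continuous_on_semidirect_maps continuous_on_subset[OF cont]) auto
  moreover have "sd_snd \<circ> extend_by_zero T \<circ> (SD 0 :: 'u \<Rightarrow> ('a, 'u) semidirect) = T"
    by (auto simp: extend_by_zero_def)
  ultimately have "continuous_on UNIV T"
    by simp
  moreover have "T (lact a y) = lact a (T y)" for a y
    using der[of "SD a 0" "SD 0 y"]
    by (simp add: extend_by_zero_def sd_mult_def semidirect_defs act_simps clinearD[OF T_lin])
  moreover have "T (ract x b) = ract (T x) b" for x b
    using der[of "SD 0 x" "SD b 0"]
    by (simp add: extend_by_zero_def sd_mult_def semidirect_defs act_simps clinearD[OF T_lin])
  moreover have "T (x * y) = x * T y + T x * y" for x y
    using der[of "SD 0 x" "SD 0 y"]
    by (simp add: extend_by_zero_def sd_mult_def semidirect_defs act_simps clinearD[OF T_lin])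
  ultimately show "T \<in> Hom_bimodule lact ract \<inter> Z1_alg times"
    using T_lin by (auto simp: Hom_bimodule_def Z1_def derivation_def)
next
  assume T: "T \<in> Hom_bimodule lact ract \<inter> Z1_alg times"
  then have T_lin: "clinear T" and cont: "continuous_on UNIV T"
    and T_eqs: "T (lact a x) = lact a (T x)" "T (ract x a) = ract (T x) a"
      "T (x * y) = x * T y + T x * y" for a x y
    by (auto simp: Hom_bimodule_def Z1_def derivation_def)
  have "continuous_on UNIV (SD 0 \<circ> T \<circ> (sd_snd :: ('a, 'u) semidirect \<Rightarrow> 'u))"
    by (intro continuous_on_compose continuous_on_semidirect_maps continuous_on_subset[OF cont]) auto
  moreover have "SD 0 \<circ> T \<circ> sd_snd = (extend_by_zero T :: ('a, 'u) semidirect \<Rightarrow> _)"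
    by (auto simp: extend_by_zero_def)
  ultimately show "extend_by_zero T \<in> Z1_alg mul"
    by (auto intro!: clinearI simp: Z1_def derivation_def extend_by_zero_def sd_mult_def
        semidirect_defs act_simps clinearD[OF T_lin] T_eqs)
qed

lemma subspace_Hom_Z1: "complex_vector.subspace (Hom_bimodule lact ract \<inter> Z1_alg times)"
proof -
  have "Hom_bimodule lact ract \<inter> Z1_alg times = extend_by_zero -` Z1_alg mul"
    using extend_by_zero_in_Z1_iff by blast
  then show ?thesis
    using clinear_extend_by_zero subspace_Z1[of mul mul mul, OF clinear_mul clinear_mul']
    by (metis Vector_Spaces.linear_def module_hom.subspace_vimage)
qed

text \<open>
  By the formula for the inner derivation of \<open>(a, x)\<close>, its values on \<open>\<A> \<times> {0}\<close> are zero exactly if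
  \<open>a\<close> is central in \<open>\<A>\<close> and \<open>x\<close> commutes with \<open>\<A>\<close>. These are the conditions that define the two
  summands on the left, and on \<open>{0} \<times> \<U>\<close> the formula then is the sum of the map in \<open>C_space\<close>
  given by \<open>a\<close> and the map in \<open>I_space\<close> given by \<open>x\<close>.
\<close>

lemma C_plus_I_eq:
  "C_space lact ract + I_space lact ract =
     {T \<in> Hom_bimodule lact ract \<inter> Z1_alg times. extend_by_zero T \<in> N1_alg mul}"
proof (intro equalityI subsetI)
  fix T assume "T \<in> C_space lact ract + I_space lact ract"
  then obtain a x where a: "inner_derivation times times a = 0"
    and x: "inner_derivation lact ract x = 0"
    and T: "T = (\<lambda>y. ract y a - lact a y) + inner_derivation times times x"
    by (auto simp: C_space_def I_space_def set_plus_def)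
  have "extend_by_zero T = inner_derivation mul mul (SD a x)"
  proof
    fix p
    show "extend_by_zero T p = inner_derivation mul mul (SD a x) p"
      by (cases p) (simp add: extend_by_zero_def inner_derivation_semidirect a x T)
  qed
  then have "extend_by_zero T \<in> N1_alg mul"
    by (simp add: N1_def)
  then show "T \<in> {T \<in> Hom_bimodule lact ract \<inter> Z1_alg times. extend_by_zero T \<in> N1_alg mul}"
    using N1_subset_Z1 extend_by_zero_in_Z1_iff by blast
next
  fix T assume "T \<in> {T \<in> Hom_bimodule lact ract \<inter> Z1_alg times. extend_by_zero T \<in> N1_alg mul}"
  then obtain p where p: "extend_by_zero T = inner_derivation mul mul p" and lin: "clinear T"
    by (auto simp: N1_def Hom_bimodule_def)
  obtain a x where ax: "p = SD a x"
    by (cases p)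
  \<comment> \<open>Below, \<open>y = 0\<close> isolates the condition on \<open>x\<close>, and \<open>b = 0\<close> gives the formula for \<open>T\<close>.\<close>
  have eq: "SD 0 (T y) = SD (inner_derivation times times a b)
      (inner_derivation lact ract x b + (ract y a - lact a y) + inner_derivation times times x y)"
    for b y
    using fun_cong[OF p, of "SD b y"] by (simp add: extend_by_zero_def ax inner_derivation_semidirect)
  have a: "inner_derivation times times a = 0"
    using eq by (auto simp: fun_eq_iff)
  have x: "inner_derivation lact ract x = 0"
  proof
    fix b
    show "inner_derivation lact ract x b = 0 b"
      using eq[where y = 0 and b = b]
      by (simp add: act_simps clinearD[OF lin]) (simp add: inner_derivation_def)
  qed
  have "T = (\<lambda>y. ract y a - lact a y) + inner_derivation times times x"
    using eq[where b = 0] by (auto simp: x)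
  then show "T \<in> C_space lact ract + I_space lact ract"
    using a x unfolding C_space_def I_space_def by blast
qed

text \<open>
  On \<open>\<A> \<times> {0}\<close> the derivation identity only involves products of an arbitrary element with elements
  of \<open>\<A> \<times> {0}\<close>, where the product of \<open>\<U>\<close> does not enter and \<open>\<A>\<close> acts on the two components
  separately.
\<close>

lemma restrictions_in_Z1:
  assumes D: "D \<in> Z1_alg mul"
  shows "(\<lambda>b. sd_fst (D (SD b 0))) \<in> Z1_alg times"
    and "(\<lambda>b. sd_snd (D (SD b 0))) \<in> Z1 times lact ract"
proof -
  have lin: "clinear D" and der: "D (mul p q) = mul p (D q) + mul (D p) q"
    and cont: "continuous_on UNIV D" for p q
    using D by (auto simp: Z1_def derivation_def)
  have "continuous_on UNIV (sd_fst \<circ> D \<circ> (\<lambda>b. SD b 0))"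
    "continuous_on UNIV (sd_snd \<circ> D \<circ> (\<lambda>b. SD b 0))"
    by (intro continuous_on_compose continuous_on_semidirect_maps continuous_on_subset[OF cont]; auto)+
  moreover have "D (SD (b + c) 0) = D (SD b 0) + D (SD c 0)"
    "D (SD (k *\<^sub>C b) 0) = k *\<^sub>C D (SD b 0)" for b c k
    using clinearD(1)[OF lin, of "SD b 0" "SD c 0"] clinearD(2)[OF lin, of k "SD b 0"]
    by (simp_all add: semidirect_defs)
  moreover have "D (SD (b * c) 0) = mul (SD b 0) (D (SD c 0)) + mul (D (SD b 0)) (SD c 0)" for b c
    using der[of "SD b 0" "SD c 0"] by (simp add: sd_mult_def act_simps)
  ultimately show "(\<lambda>b. sd_fst (D (SD b 0))) \<in> Z1_alg times"
    "(\<lambda>b. sd_snd (D (SD b 0))) \<in> Z1 times lact ract"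
    by (auto intro!: clinearI simp: Z1_def derivation_def o_def semidirect_defs sd_mult_def act_simps)
qed

text \<open>
  On \<open>\<A> \<times> {0}\<close> the two components of \<open>D\<close> are inner, given by some \<open>a\<close> and \<open>x\<close>, so \<open>D\<close> agrees there with
  the inner derivation of \<open>(a, x)\<close>. The difference vanishes on \<open>\<A> \<times> {0}\<close> and, being itself a
  derivation, preserves \<open>{0} \<times> \<U>\<close>; such a map is an extension by zero.
\<close>

lemma Z1_subset_extensions_plus_N1:
  assumes inv: "\<forall>D. derivation mul mul mul D \<longrightarrow> D ` range (SD 0) \<subseteq> range (SD 0)"
    and H1_A: "H1_alg (times :: 'a \<Rightarrow> 'a \<Rightarrow> 'a) = {N1_alg times}"
    and H1_U: "H1 times lact ract = {N1 lact ract}"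
  shows "Z1_alg mul \<subseteq> extend_by_zero ` (Hom_bimodule lact ract \<inter> Z1_alg times) + N1_alg mul"
proof
  fix D assume D: "D \<in> Z1_alg mul"
  obtain a where a: "(\<lambda>b. sd_fst (D (SD b 0))) = inner_derivation times times a"
    using inner_if_H1_trivial[OF clinear_times H1_A restrictions_in_Z1(1)[OF D]] .
  obtain x where x: "(\<lambda>b. sd_snd (D (SD b 0))) = inner_derivation lact ract x"
    using inner_if_H1_trivial[OF lact_clinear_right ract_clinear_left H1_U restrictions_in_Z1(2)[OF D]] .
  define E where "E = D - inner_derivation mul mul (SD a x)"
  have N1: "inner_derivation mul mul (SD a x) \<in> N1_alg mul"
    by (simp add: N1_def)
  have E: "E \<in> Z1_alg mul"
    unfolding E_def using D N1 N1_subset_Z1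
    by (intro complex_vector.subspace_diff[OF subspace_Z1[OF clinear_mul clinear_mul']]) auto
  then have lin: "clinear E" and der: "derivation mul mul mul E"
    by (auto simp: Z1_def derivation_def)
  have "D (SD b 0) = SD (inner_derivation times times a b) (inner_derivation lact ract x b)" for b
    using fun_cong[OF a, of b] fun_cong[OF x, of b] by (simp add: semidirect.expand)
  then have E_A: "E (SD b 0) = 0" for b
    by (simp add: E_def inner_derivation_semidirect act_simps)
      (simp add: semidirect_defs inner_derivation_def)
  have E_U: "E (SD 0 y) = SD 0 (sd_snd (E (SD 0 y)))" for y
    using inv[rule_format, OF der] by (auto simp: image_subset_iff image_iff) (metis semidirect.sel(2))
  have "E = extend_by_zero (\<lambda>y. sd_snd (E (SD 0 y)))"
  proof
    fix p :: "('a, 'u) semidirect"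
    have "p = SD (sd_fst p) 0 + SD 0 (sd_snd p)"
      by (simp add: semidirect_defs)
    then have "E p = E (SD (sd_fst p) 0) + E (SD 0 (sd_snd p))"
      using clinearD(1)[OF lin] by metis
    also have "\<dots> = SD 0 (sd_snd (E (SD 0 (sd_snd p))))"
      using E_A E_U by simp
    finally show "E p = extend_by_zero (\<lambda>y. sd_snd (E (SD 0 y))) p"
      by (simp add: extend_by_zero_def)
  qed
  then have "E \<in> extend_by_zero ` (Hom_bimodule lact ract \<inter> Z1_alg times)"
    using E extend_by_zero_in_Z1_iff by (metis imageI)
  moreover have "D = E + inner_derivation mul mul (SD a x)"
    by (simp add: E_def)
  ultimately show "D \<in> extend_by_zero ` (Hom_bimodule lact ract \<inter> Z1_alg times) + N1_alg mul"
    using N1 by blast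
qed

end


section \<open>The first cohomology of the semidirect product\<close>

theorem theorem4p9:
  fixes lact :: "'a::complex_banach_algebra \<Rightarrow> 'u::complex_banach_algebra \<Rightarrow> 'u"
    and ract :: "'u \<Rightarrow> 'a \<Rightarrow> 'u"
  assumes "compatible_bimodule lact ract"
    and "\<forall>D. derivation (sd_mult lact ract) (sd_mult lact ract) (sd_mult lact ract) D \<longrightarrow>
           D ` range (SD 0) \<subseteq> range (SD 0)"
    and "H1_alg (times :: 'a \<Rightarrow> 'a \<Rightarrow> 'a) = {N1_alg times}"
    and "H1 times lact ract = {N1 lact ract}"
  shows "cosets_isomorphic
           (H1_alg (sd_mult lact ract)) (coset_scale (N1_alg (sd_mult lact ract)))
           (quotient_space (Hom_bimodule lact ract \<inter> Z1_alg times)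
              (C_space lact ract + I_space lact ract))
           (coset_scale (C_space lact ract + I_space lact ract))"
proof -
  interpret compatible_bimodule lact ract
    by (rule assms(1))
  show ?thesis
    unfolding H1_def
  proof (rule cosets_isomorphic_if_represented)
    show "extend_by_zero ` (Hom_bimodule lact ract \<inter> Z1_alg times) \<subseteq> Z1_alg mul"
      using extend_by_zero_in_Z1_iff by blast
  qed (fact subspace_Hom_Z1 subspace_N1[OF clinear_mul clinear_mul'] clinear_extend_by_zero
      Z1_subset_extensions_plus_N1[OF assms(2-4)] C_plus_I_eq)+
qed

end
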